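(* For any row-finite directed graph $E$, the associated monoid $M_E$ is a refinement monoid.
   Context: A directed graph $E=(E^0,E^1)$ consists of a vertex set $E^0$, an edge set $E^1$, and maps $r,s\colon E^1\to E^0$ (range and source). A vertex $v$ emits edges if $s^{-1}(v)\neq\emptyset$. $E$ is row-finite if each vertex emits only finitely many edges. $M_E$ is the abelian monoid with generators $\{a_v\mid v\in E^0\}$ and relations $a_v=\sum_{\{e\in E^1\mid s(e)=v\}}a_{r(e)}$ for every $v\in E^0$ that emits edges. An abelian monoid $M$ is a refinement monoid if whenever $a+b=c+d$ in $M$, there exist $x,y,z,t\in M$ such that $a=x+y$, $b=z+t$, $c=x+z$ and $d=y+t$. *)

theory Defs
  imports
    "HOL-Library.Multiset"
    "HOL-Algebra.Group"
    "Graph_Theory.Digraph"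
begin

section \<open>Abelian monoids given by generators and relations\<close>

text \<open>
  The free abelian monoid on a set X is modelled by the finite multisets with support in X,
  with the generator of x being the multiset {#x#}.  The abelian monoid presented by X and a
  set R of pairs of elements of the free monoid is the quotient of the latter by the least
  congruence containing R.
\<close>

definition free_multisets :: "'a set \<Rightarrow> 'a multiset set" where
  "free_multisets X = {m. set_mset m \<subseteq> X}"

inductive_set presented_cong ::
    "'a set \<Rightarrow> ('a multiset \<times> 'a multiset) set \<Rightarrow> ('a multiset \<times> 'a multiset) set"
  for X :: "'a set" and R :: "('a multiset \<times> 'a multiset) set" where
  base: "(m, n) \<in> R \<Longrightarrow> (m, n) \<in> presented_cong X R"
| refl: "m \<in> free_multisets X \<Longrightarrow> (m, m) \<in> presented_cong X R"
| sym: "(m, n) \<in> presented_cong X R \<Longrightarrow> (n, m) \<in> presented_cong X R"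
| trans: "(m, n) \<in> presented_cong X R \<Longrightarrow> (n, k) \<in> presented_cong X R
    \<Longrightarrow> (m, k) \<in> presented_cong X R"
| add: "(m, n) \<in> presented_cong X R \<Longrightarrow> (k, l) \<in> presented_cong X R
    \<Longrightarrow> (m + k, n + l) \<in> presented_cong X R"

text \<open>
  The abelian monoid is written multiplicatively, as usual for monoid records; the union in
  \<open>mult\<close> ranges over all representatives and yields the single class of the sum.
\<close>

definition presented_monoid ::
    "'a set \<Rightarrow> ('a multiset \<times> 'a multiset) set \<Rightarrow> 'a multiset set monoid" where
  "presented_monoid X R =
    \<lparr> carrier = free_multisets X // presented_cong X R,
      mult = (\<lambda>A B. \<Union>m\<in>A. \<Union>n\<in>B. presented_cong X R `` {m + n}),
      one = presented_cong X R `` {{#}} \<rparr>"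

section \<open>Refinement monoids\<close>

locale refinement_monoid = comm_monoid M for M (structure) +
  assumes refinement:
    "\<lbrakk> a \<in> carrier M; b \<in> carrier M; c \<in> carrier M; d \<in> carrier M; a \<otimes> b = c \<otimes> d \<rbrakk> \<Longrightarrow>
      \<exists>x\<in>carrier M. \<exists>y\<in>carrier M. \<exists>z\<in>carrier M. \<exists>t\<in>carrier M.
        a = x \<otimes> y \<and> b = z \<otimes> t \<and> c = x \<otimes> z \<and> d = y \<otimes> t"

section \<open>The monoid of a row-finite directed graph\<close>

text \<open>
  The source and range maps are \<^const>\<open>tail\<close> and \<^const>\<open>head\<close>.  Loops, parallel
  arcs and infinitely many vertices or arcs are allowed.
\<close>

locale row_finite_digraph = wf_digraph +
  assumes finite_out_arcs: "v \<in> verts G \<Longrightarrow> finite (out_arcs G v)"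

text \<open>
  Parallel arcs contribute with multiplicity.  As \<^const>\<open>mset_set\<close> sends infinite sets to
  the empty multiset, these relations are meaningful for row-finite graphs only.
\<close>

definition graph_monoid_rels :: "('a, 'b) pre_digraph \<Rightarrow> ('a multiset \<times> 'a multiset) set" where
  "graph_monoid_rels G =
    {({#v#}, image_mset (head G) (mset_set (out_arcs G v))) | v.
      v \<in> verts G \<and> out_arcs G v \<noteq> {}}"

definition graph_monoid :: "('a, 'b) pre_digraph \<Rightarrow> 'a multiset set monoid" where
  "graph_monoid G = presented_monoid (verts G) (graph_monoid_rels G)"

end

theory Submission
  imports Defs "HOL-Library.Confluence"
begin

text \<open>
  Read every defining relation \<open>a\<^sub>v = \<Sum> a\<^bsub>r(e)\<^esub>\<close> as a rewrite rule on finite multisets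
  of vertices: one occurrence of \<open>v\<close> may be replaced by the multiset of the ranges of the
  edges that it emits.  Two features of these rules make the monoid a refinement monoid.

  First, each vertex is the left-hand side of at most one rule.  Two different rewrite
  steps from the same multiset therefore consume different occurrences and commute, so
  rewriting is confluent (\<open>confluent_rewrite\<close>), and two multisets represent the same
  element iff they rewrite to a common multiset (\<open>presented_cong_iff_joinable\<close>).

  Second, each left-hand side is a single generator.  A step on a sum thus takes place inside
  one of the summands, so whatever \<open>a + b\<close> rewrites to splits as \<open>a' + b'\<close>, where \<open>a\<close>
  rewrites to \<open>a'\<close> and \<open>b\<close> to \<open>b'\<close> (\<open>rewrites_add_split\<close>).

  Hence, if \<open>a + b\<close> and \<open>c + d\<close> represent the same element, they rewrite to a common
  multiset \<open>a' + b' = c' + d'\<close>, in which the primed letters represent the same elements as the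
  unprimed ones.  This last equation holds in a free abelian monoid, which has refinement
  (\<open>multiset_refinement\<close>), and the four pieces found there represent a refinement of the
  original equation.  The argument works for every presentation whose rules have the two
  features, and is carried out in that generality.
\<close>

section \<open>Presented abelian monoids\<close>

lemma add_in_free_multisets_iff [simp]:
  "m + n \<in> free_multisets X \<longleftrightarrow> m \<in> free_multisets X \<and> n \<in> free_multisets X"
  by (auto simp: free_multisets_def)

lemma empty_in_free_multisets [simp]: "{#} \<in> free_multisets X"
  by (simp add: free_multisets_def)

lemma presented_cong_in_free_multisets:
  assumes "R \<subseteq> free_multisets X \<times> free_multisets X" and "(m, n) \<in> presented_cong X R"
  shows "m \<in> free_multisets X \<and> n \<in> free_multisets X"
  using assms(2) by induction (use assms(1) in auto)

lemma equiv_presented_cong: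
  assumes "R \<subseteq> free_multisets X \<times> free_multisets X"
  shows "equiv (free_multisets X) (presented_cong X R)"
proof (rule equivI)
  show "presented_cong X R \<subseteq> free_multisets X \<times> free_multisets X"
    using presented_cong_in_free_multisets[OF assms] by auto
  show "refl_on (free_multisets X) (presented_cong X R)"
    by (simp add: refl_on_def presented_cong.refl)
  show "sym (presented_cong X R)"
    by (auto intro: symI presented_cong.sym)
  show "trans (presented_cong X R)"
    by (auto intro: transI presented_cong.trans)
qed

lemma presented_class_eq_iff:
  assumes "R \<subseteq> free_multisets X \<times> free_multisets X"
    and "m \<in> free_multisets X" and "n \<in> free_multisets X"
  shows "presented_cong X R `` {m} = presented_cong X R `` {n} \<longleftrightarrow> (m, n) \<in> presented_cong X R"
  using eq_equiv_class_iff[OF equiv_presented_cong[OF assms(1)]] assms(2,3) .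

lemma mult_presented_classes:
  assumes R: "R \<subseteq> free_multisets X \<times> free_multisets X"
    and m: "m \<in> free_multisets X" and n: "n \<in> free_multisets X"
  shows "presented_cong X R `` {m} \<otimes>\<^bsub>presented_monoid X R\<^esub> presented_cong X R `` {n}
    = presented_cong X R `` {m + n}"
proof -
  let ?cl = "\<lambda>m. presented_cong X R `` {m}"
  have "?cl (m' + n') = ?cl (m + n)" if "m' \<in> ?cl m" and "n' \<in> ?cl n" for m' n'
    using equiv_class_eq[OF equiv_presented_cong[OF R] presented_cong.add] that by blast
  then have "(\<Union>m'\<in>?cl m. \<Union>n'\<in>?cl n. ?cl (m' + n')) = (\<Union>m'\<in>?cl m. \<Union>n'\<in>?cl n. ?cl (m + n))"
    by (intro SUP_cong HOL.refl)
  also have "\<dots> = ?cl (m + n)"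
    using presented_cong.refl[OF m] presented_cong.refl[OF n] by blast
  finally show ?thesis
    by (simp add: presented_monoid_def)
qed

lemma presented_carrier_cases:
  assumes "A \<in> carrier (presented_monoid X R)"
  obtains m where "m \<in> free_multisets X" and "A = presented_cong X R `` {m}"
  using assms by (auto simp: presented_monoid_def elim: quotientE)

lemma presented_class_in_carrier:
  "m \<in> free_multisets X \<Longrightarrow> presented_cong X R `` {m} \<in> carrier (presented_monoid X R)"
  by (simp add: presented_monoid_def quotientI)

lemma comm_monoid_presented_monoid:
  assumes R: "R \<subseteq> free_multisets X \<times> free_multisets X"
  shows "comm_monoid (presented_monoid X R)"
proof -
  have one: "\<one>\<^bsub>presented_monoid X R\<^esub> = presented_cong X R `` {{#}}"
    by (simp add: presented_monoid_def)
  show ?thesis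
    by (rule comm_monoidI; (elim presented_carrier_cases)?;
      simp add: one mult_presented_classes[OF R] presented_class_in_carrier ac_simps)
qed

section \<open>Rewriting one generator at a time\<close>

inductive rewrite :: "('a multiset \<times> 'a multiset) set \<Rightarrow> 'a multiset \<Rightarrow> 'a multiset \<Rightarrow> bool"
  for R where
  rewriteI: "(m, n) \<in> R \<Longrightarrow> rewrite R (m + k) (n + k)"

lemma rewrite_single_generatorE:
  assumes "rewrite R x y" and "Domain R \<subseteq> range (\<lambda>v. {#v#})"
  obtains v n k where "({#v#}, n) \<in> R" and "x = {#v#} + k" and "y = n + k"
  using assms(1)
proof cases
  case (rewriteI m n k)
  with assms(2) obtain v where "m = {#v#}" by blast
  with rewriteI that show thesis by blast
qed

lemma rewrite_add_right: "rewrite R m n \<Longrightarrow> rewrite R (m + k) (n + k)"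
  by (metis add.assoc rewrite.simps)

lemma rewrites_add:
  assumes "(rewrite R)\<^sup>*\<^sup>* m n" and "(rewrite R)\<^sup>*\<^sup>* k l"
  shows "(rewrite R)\<^sup>*\<^sup>* (m + k) (n + l)"
proof -
  have right: "(rewrite R)\<^sup>*\<^sup>* (p + u) (q + u)" if "(rewrite R)\<^sup>*\<^sup>* p q" for p q u
    using that
    by (rule rtranclp.induct) (blast intro: rewrite_add_right rtranclp.rtrancl_into_rtrancl)+
  have "(rewrite R)\<^sup>*\<^sup>* (n + k) (n + l)"
    using right[OF assms(2), of n] by (simp add: add.commute)
  with right[OF assms(1)] show ?thesis
    by (rule rtranclp_trans)
qed

lemma rewrites_imp_presented_cong:
  assumes R: "R \<subseteq> free_multisets X \<times> free_multisets X"
    and "(rewrite R)\<^sup>*\<^sup>* m n" and "m \<in> free_multisets X"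
  shows "(m, n) \<in> presented_cong X R"
  using assms(2)
proof induction
  case base
  then show ?case using assms(3) by (rule presented_cong.refl)
next
  case (step n p)
  from \<open>rewrite R n p\<close> have "(n, p) \<in> presented_cong X R"
  proof cases
    case (rewriteI u v k)
    moreover have "n \<in> free_multisets X"
      using presented_cong_in_free_multisets[OF R step.IH] by simp
    ultimately show ?thesis
      by (auto intro: presented_cong.add presented_cong.base presented_cong.refl)
  qed
  with step.IH show ?case by (rule presented_cong.trans)
qed

text \<open>
  A single generator in a sum belongs to one of the summands, so every step from \<open>a + b\<close>
  is a step from \<open>a\<close> or a step from \<open>b\<close>.  A rule consuming two generators at once
  could take one from each summand, and the lemma would fail.
\<close>

lemma rewrites_add_split:
  assumes single: "Domain R \<subseteq> range (\<lambda>v. {#v#})"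
    and "(rewrite R)\<^sup>*\<^sup>* (a + b) p"
  shows "\<exists>a' b'. p = a' + b' \<and> (rewrite R)\<^sup>*\<^sup>* a a' \<and> (rewrite R)\<^sup>*\<^sup>* b b'"
  using assms(2)
proof induction
  case base
  then show ?case by blast
next
  case (step p q)
  then obtain a' b' where p: "p = a' + b'"
    and a': "(rewrite R)\<^sup>*\<^sup>* a a'" and b': "(rewrite R)\<^sup>*\<^sup>* b b'"
    by blast
  from \<open>rewrite R p q\<close> obtain v n k
    where vn: "({#v#}, n) \<in> R" and pk: "p = {#v#} + k" and q: "q = n + k"
    using single by (rule rewrite_single_generatorE)
  from p pk have "v \<in># a' \<or> v \<in># b'"
    by (metis add_mset_add_single union_commute union_iff union_single_eq_member)
  then show ?case
  proof
    assume "v \<in># a'"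
    then obtain u where u: "a' = {#v#} + u"
      by (metis insert_DiffM2 union_commute)
    with p pk q have "q = (n + u) + b'" by simp
    moreover have "rewrite R a' (n + u)"
      unfolding u using vn by (rule rewriteI)
    ultimately show ?thesis
      using a' b' by (blast intro: rtranclp.rtrancl_into_rtrancl)
  next
    assume "v \<in># b'"
    then obtain u where u: "b' = {#v#} + u"
      by (metis insert_DiffM2 union_commute)
    with p pk q have "q = a' + (n + u)" by (simp add: ac_simps)
    moreover have "rewrite R b' (n + u)"
      unfolding u using vn by (rule rewriteI)
    ultimately show ?thesis
      using a' b' by (blast intro: rtranclp.rtrancl_into_rtrancl)
  qed
qed

section \<open>Confluence\<close>

text \<open>
  Two steps from the same multiset consume occurrences of generators \<open>v\<close> and \<open>w\<close>.  If
  \<open>v = w\<close>, then both use the same rule and have the same result, whichever occurrences they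
  consume.  If \<open>v \<noteq> w\<close>, each step leaves the generator of the other one in place, and one
  further step on either side leads to a common result.
\<close>

lemma confluent_rewrite:
  assumes single: "Domain R \<subseteq> range (\<lambda>v. {#v#})"
    and functional: "single_valued R"
  shows "confluentp (rewrite R)"
proof (rule strong_confluentp_imp_confluentp, rule strong_confluentpI)
  fix x y y'
  assume "rewrite R x y" and "rewrite R x y'"
  then obtain v n k w l j
    where v: "({#v#}, n) \<in> R" "x = {#v#} + k" "y = n + k"
      and w: "({#w#}, l) \<in> R" "x = {#w#} + j" "y' = l + j"
    using single by (metis rewrite_single_generatorE)
  show "\<exists>z. (rewrite R)\<^sup>*\<^sup>* y z \<and> (rewrite R)\<^sup>=\<^sup>= y' z"
  proof (cases "v = w")
    case True
    then have "y = y'"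
      using v w functional by (auto dest: single_valuedD)
    then show ?thesis by auto
  next
    case False
    with v w obtain u where u: "k = {#w#} + u" "j = {#v#} + u"
      by (auto simp: add_eq_conv_ex)
    have "rewrite R y (l + (n + u))"
      using rewriteI[OF w(1), of "n + u"] v(3) u by (simp add: ac_simps)
    moreover have "rewrite R y' (l + (n + u))"
      using rewriteI[OF v(1), of "l + u"] w(3) u by (simp add: ac_simps)
    ultimately show ?thesis by blast
  qed
qed

text \<open>
  Joinability contains the relations, is reflexive and symmetric, and is compatible with
  addition; confluence supplies transitivity.  It is therefore a congruence containing
  \<open>R\<close>, and it contains the least one.
\<close>

lemma presented_cong_iff_joinable:
  assumes R: "R \<subseteq> free_multisets X \<times> free_multisets X"
    and confl: "confluentp (rewrite R)"
    and free: "m \<in> free_multisets X" "n \<in> free_multisets X"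
  shows "(m, n) \<in> presented_cong X R \<longleftrightarrow> (\<exists>p. (rewrite R)\<^sup>*\<^sup>* m p \<and> (rewrite R)\<^sup>*\<^sup>* n p)"
proof
  assume "(m, n) \<in> presented_cong X R"
  then show "\<exists>p. (rewrite R)\<^sup>*\<^sup>* m p \<and> (rewrite R)\<^sup>*\<^sup>* n p"
  proof induction
    case (base m n)
    then have "rewrite R m n"
      using rewriteI[of m n R "{#}"] by simp
    then show ?case by blast
  next
    case (refl m)
    then show ?case by blast
  next
    case (sym m n)
    then show ?case by blast
  next
    case (trans m n k)
    then obtain p q where "(rewrite R)\<^sup>*\<^sup>* m p" "(rewrite R)\<^sup>*\<^sup>* n p"
      and "(rewrite R)\<^sup>*\<^sup>* n q" "(rewrite R)\<^sup>*\<^sup>* k q"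
      by blast
    moreover from this confl obtain u where "(rewrite R)\<^sup>*\<^sup>* p u" "(rewrite R)\<^sup>*\<^sup>* q u"
      by (blast dest: confluentpD)
    ultimately show ?case by (meson rtranclp_trans)
  next
    case (add m n k l)
    then show ?case by (blast intro: rewrites_add)
  qed
next
  assume "\<exists>p. (rewrite R)\<^sup>*\<^sup>* m p \<and> (rewrite R)\<^sup>*\<^sup>* n p"
  then show "(m, n) \<in> presented_cong X R"
    using rewrites_imp_presented_cong[OF R] free
    by (blast intro: presented_cong.sym presented_cong.trans)
qed

section \<open>Refinement\<close>

lemma multiset_refinement:
  fixes a b c d :: "'a multiset"
  assumes "a + b = c + d"
  shows "\<exists>x y z t. a = x + y \<and> b = z + t \<and> c = x + z \<and> d = y + t"
proof -
  \<comment> \<open>\<open>x\<close> is chosen as large as possible.  What is left of \<open>c\<close> is then disjoint from what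
    is left of \<open>a\<close>, and so it must be part of \<open>b\<close>.\<close>
  have count: "count a v + count b v = count c v + count d v" for v
    using assms by (metis count_union)
  have "a = a \<inter># c + (a - c)" "c = a \<inter># c + (c - a)"
    by (auto simp: multiset_eq_iff min_def)
  moreover have "b = (c - a) + (b - (c - a))" "d = (a - c) + (b - (c - a))"
  proof (rule_tac [!] multiset_eqI)
    fix v
    show "count b v = count ((c - a) + (b - (c - a))) v"
      using count[of v] by simp
    show "count d v = count ((a - c) + (b - (c - a))) v"
      using count[of v] by simp
  qed
  ultimately show ?thesis by blast
qed

lemma refinement_monoid_presented_monoid:
  assumes R: "R \<subseteq> free_multisets X \<times> free_multisets X"
    and single: "Domain R \<subseteq> range (\<lambda>v. {#v#})"
    and functional: "single_valued R"
  shows "refinement_monoid (presented_monoid X R)"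
proof -
  let ?M = "presented_monoid X R" and ?cl = "\<lambda>m. presented_cong X R `` {m}"
  interpret comm_monoid ?M
    using R by (rule comm_monoid_presented_monoid)
  have confl: "confluentp (rewrite R)"
    using single functional by (rule confluent_rewrite)
  note mult = mult_presented_classes[OF R]
  have class_rewrites: "?cl m' = ?cl m \<and> m' \<in> free_multisets X"
    if "(rewrite R)\<^sup>*\<^sup>* m m'" and "m \<in> free_multisets X" for m m'
  proof -
    have "(m, m') \<in> presented_cong X R"
      using R that by (rule rewrites_imp_presented_cong)
    then show ?thesis
      using presented_cong_in_free_multisets[OF R] presented_class_eq_iff[OF R] by metis
  qed
  show ?thesis
  proof
    fix A B C D
    assume carrier: "A \<in> carrier ?M" "B \<in> carrier ?M" "C \<in> carrier ?M" "D \<in> carrier ?M"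
      and eq: "A \<otimes>\<^bsub>?M\<^esub> B = C \<otimes>\<^bsub>?M\<^esub> D"
    obtain a b c d where free: "a \<in> free_multisets X" "b \<in> free_multisets X"
        "c \<in> free_multisets X" "d \<in> free_multisets X"
      and ABCD: "A = ?cl a" "B = ?cl b" "C = ?cl c" "D = ?cl d"
      using carrier by (meson presented_carrier_cases)
    have "(a + b, c + d) \<in> presented_cong X R"
      using eq free by (simp add: ABCD mult presented_class_eq_iff[OF R])
    then obtain p where ab: "(rewrite R)\<^sup>*\<^sup>* (a + b) p" and cd: "(rewrite R)\<^sup>*\<^sup>* (c + d) p"
      using presented_cong_iff_joinable[OF R confl] free by auto
    obtain a' b' where p1: "p = a' + b'"
      and a': "(rewrite R)\<^sup>*\<^sup>* a a'" and b': "(rewrite R)\<^sup>*\<^sup>* b b'"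
      using rewrites_add_split[OF single ab] by blast
    obtain c' d' where p2: "p = c' + d'"
      and c': "(rewrite R)\<^sup>*\<^sup>* c c'" and d': "(rewrite R)\<^sup>*\<^sup>* d d'"
      using rewrites_add_split[OF single cd] by blast
    obtain x y z t
      where xyzt: "a' = x + y" "b' = z + t" "c' = x + z" "d' = y + t"
      using multiset_refinement[OF HOL.trans[OF p1[symmetric] p2]] by blast
    note classes = class_rewrites[OF a' free(1)] class_rewrites[OF b' free(2)]
      class_rewrites[OF c' free(3)] class_rewrites[OF d' free(4)]
    have parts: "x \<in> free_multisets X" "y \<in> free_multisets X"
        "z \<in> free_multisets X" "t \<in> free_multisets X"
      using classes unfolding xyzt by simp_all
    have "?cl (x + y) = A" "?cl (z + t) = B" "?cl (x + z) = C" "?cl (y + t) = D"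
      using classes unfolding xyzt ABCD by blast+
    with parts have "A = ?cl x \<otimes>\<^bsub>?M\<^esub> ?cl y" "B = ?cl z \<otimes>\<^bsub>?M\<^esub> ?cl t"
      "C = ?cl x \<otimes>\<^bsub>?M\<^esub> ?cl z" "D = ?cl y \<otimes>\<^bsub>?M\<^esub> ?cl t"
      by (simp_all add: mult)
    with parts show "\<exists>x\<in>carrier ?M. \<exists>y\<in>carrier ?M. \<exists>z\<in>carrier ?M. \<exists>t\<in>carrier ?M.
        A = x \<otimes>\<^bsub>?M\<^esub> y \<and> B = z \<otimes>\<^bsub>?M\<^esub> t \<and> C = x \<otimes>\<^bsub>?M\<^esub> z \<and> D = y \<otimes>\<^bsub>?M\<^esub> t"
      using presented_class_in_carrier by blast
  qed
qed

theorem proposition4p4: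
  fixes E :: "('a, 'b) pre_digraph"
  assumes "row_finite_digraph E"
  shows "refinement_monoid (graph_monoid E)"
proof -
  interpret row_finite_digraph E by (fact assms)
  have "graph_monoid_rels E \<subseteq> free_multisets (verts E) \<times> free_multisets (verts E)"
    using finite_out_arcs by (auto simp: graph_monoid_rels_def free_multisets_def)
  moreover have "Domain (graph_monoid_rels E) \<subseteq> range (\<lambda>v. {#v#})"
    by (auto simp: graph_monoid_rels_def)
  moreover have "single_valued (graph_monoid_rels E)"
    by (auto simp: graph_monoid_rels_def single_valued_def)
  ultimately show ?thesis
    unfolding graph_monoid_def by (rule refinement_monoid_presented_monoid)
qed

end
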